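(* Let $f(x),g(x)\in\mathbb Q(x)$, not both constant, and let $p$ be an odd prime. For any primitive character $\chi$ modulo $p^m$ with $m\ge2$, there exists an integer $C_\chi\in[1,p^{m-1}]$ not divisible by $p$ such that the following holds. Let $h(x):=g'(x)+C_\chi f'(x)/f(x)$ and suppose $h(x)=p^\tau H(x)$ for some integer $\tau\ge0$ and some $H\in\mathbb Q(x)$ with $H\not\equiv 0\pmod p$. Then $$\Big|\frac1{p^m}\sum_{n\bmod p^m}\chi(f(n))\,e\Big(\frac{g(n)}{p^m}\Big)\Big|\le D\,p^{-\lceil\frac{m-\tau-1}{2D}\rceil},$$ where $D:=\deg_p H_+$.
   Context: $e(x)=e^{2\pi i x}$. For $R\in\mathbb Q(x)$ write $R=R_+/R_-$ with $R_\pm\in\mathbb Z[x]$ coprime; $\deg_p R$ denotes the degree of the reduction modulo $p$. $\chi(f(n)):=\chi(f_+(n))\overline{\chi(f_-(n))}$ (zero if $p\mid f_-(n)$), and $e(g(n)/p^m)$ is computed via reduction modulo $p^m$, being $0$ if $g_-(n)\equiv0\pmod p$.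
   Formalization: The formal statement assumes D ≥ 1; for D = 0 the exponent (m−τ−1)/(2D) in the bound is undefined (division by zero), and reading the bound as 0 fails e.g. for f = 1, g = p^m x, τ = m. *)

theory Defs
  imports "HOL-Analysis.Analysis" "HOL-Computational_Algebra.Polynomial"
          "HOL-Number_Theory.Cong"
begin

definition dirichlet_char :: "nat \<Rightarrow> (int \<Rightarrow> complex) \<Rightarrow> bool" where
  "dirichlet_char N chi \<longleftrightarrow> N > 0 \<and>
     (\<forall>a b. chi (a * b) = chi a * chi b) \<and>
     chi 1 = 1 \<and>
     (\<forall>a. chi (a + int N) = chi a) \<and>
     (\<forall>a. chi a = 0 \<longleftrightarrow> \<not> coprime a (int N))"

definition primitive_char :: "nat \<Rightarrow> (int \<Rightarrow> complex) \<Rightarrow> bool" where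
  "primitive_char N chi \<longleftrightarrow> dirichlet_char N chi \<and>
     (\<forall>d. d dvd N \<and> d < N \<longrightarrow>
        (\<exists>a. coprime a (int N) \<and> [a = 1] (mod int d) \<and> chi a \<noteq> 1))"

definition ee :: "real \<Rightarrow> complex" where
  "ee x = exp (2 * of_real pi * \<i> * of_real x)"

text \<open>A rational function R = R_+ / R_- is represented by the pair (R_+, R_-) of
  coprime integer polynomials with R_- nonzero.\<close>
definition rat_fun :: "int poly \<Rightarrow> int poly \<Rightarrow> bool" where
  "rat_fun Rp Rm \<longleftrightarrow> Rm \<noteq> 0 \<and> coprime Rp Rm"

definition rat_fun_const :: "int poly \<Rightarrow> int poly \<Rightarrow> bool" where
  "rat_fun_const Rp Rm \<longleftrightarrow> degree Rp = 0 \<and> degree Rm = 0"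

definition nonzero_mod :: "nat \<Rightarrow> int poly \<Rightarrow> bool" where
  "nonzero_mod p P \<longleftrightarrow> (\<exists>i. \<not> int p dvd coeff P i)"

definition deg_mod :: "nat \<Rightarrow> int poly \<Rightarrow> nat" where
  "deg_mod p P = (if nonzero_mod p P then Max {i. \<not> int p dvd coeff P i} else 0)"

definition char_rat :: "nat \<Rightarrow> (int \<Rightarrow> complex) \<Rightarrow> int poly \<Rightarrow> int poly \<Rightarrow> int \<Rightarrow> complex" where
  "char_rat p chi Rp Rm n =
     (if int p dvd poly Rm n then 0 else chi (poly Rp n) * cnj (chi (poly Rm n)))"

text \<open>e(g(n)/p^m), with g(n) reduced modulo p^m; zero if p divides g_-(n).\<close>
definition add_rat :: "nat \<Rightarrow> nat \<Rightarrow> int poly \<Rightarrow> int poly \<Rightarrow> int \<Rightarrow> complex" where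
  "add_rat p m Rp Rm n =
     (if int p dvd poly Rm n then 0
      else ee (real_of_int (SOME t. [t * poly Rm n = poly Rp n] (mod (int p ^ m))) / real (p ^ m)))"

end

theory Submission
  imports Defs "HOL-Computational_Algebra.Polynomial_Factorial"
begin

text \<open>Put \<open>P = p^M\<close> with \<open>M\<close> large. On \<open>u \<equiv> 1 (mod p)\<close> the function \<open>(u^P - 1) / P\<close> is a logarithm modulo
  \<open>p^m\<close>, so \<open>\<chi>(u) = e(C (u^P - 1) / p^(M+m))\<close>, which determines \<open>C\<close>. After rescaling \<open>f\<^sub>+\<close>, \<open>f\<^sub>-\<close>, \<open>g\<^sub>-\<close> to be \<open>1\<close>
  modulo \<open>p\<close> at \<open>a\<close>, every term at \<open>n = a + p y\<close> is a constant times \<open>e(T(y) / p^(M+m))\<close> for one integer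
  polynomial \<open>T\<close>, whose derivative is a unit multiple of \<open>p^(M+1) h\<close> modulo \<open>p^(2M)\<close>.
  If \<open>h\<close> has exact \<open>p\<close>-power \<open>p^t\<close> and \<open>2k + t \<ge> m\<close>, then \<open>T\<close> is linear along \<open>n = a + p^k b\<close>, and
  the sum over \<open>b\<close> vanishes unless \<open>p^r\<close> divides \<open>H\<^sub>+(a)\<close>, where \<open>r = m - k - t\<close>. With \<open>r = (m - t) div 2\<close>
  and \<open>D (e - 1) < r\<close>, such \<open>a\<close> lie in at most \<open>D\<close> residue classes modulo \<open>p^e\<close>.\<close>

lemma dvd_power_diff:
  fixes x y :: "'a::comm_ring_1"
  assumes "of_nat p ^ s dvd x - y" "s \<ge> 1"
  shows "of_nat p ^ (s + M) dvd x ^ (p ^ M) - y ^ (p ^ M)"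
proof (induction M)
  case (Suc M)
  let ?X = "x ^ (p ^ M)" and ?Y = "y ^ (p ^ M)"
  obtain d where d: "?X = ?Y + of_nat p ^ (s + M) * d"
    using Suc.IH by (metis diff_add_cancel add.commute dvdE)
  have "of_nat p dvd ?X ^ i - ?Y ^ i" for i
  proof -
    have "of_nat p dvd ?X - ?Y"
      using Suc.IH assms(2) dvd_power[of "s + M" "of_nat p :: 'a"] dvd_trans by fastforce
    thus ?thesis by (metis power_diff_sumr2 dvd_mult2)
  qed
  hence "of_nat p dvd (\<Sum>i<p. ?Y ^ (p - Suc i) * (?X ^ i - ?Y ^ i))"
    by (intro dvd_sum dvd_mult)
  also have "(\<Sum>i<p. ?Y ^ (p - Suc i) * (?X ^ i - ?Y ^ i))
     = (\<Sum>i<p. ?Y ^ (p - Suc i) * ?X ^ i) - (\<Sum>i<p. ?Y ^ (p - 1))"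
    unfolding sum_subtractf[symmetric]
    by (intro sum.cong) (auto simp: algebra_simps simp flip: power_add)
  finally have "of_nat p dvd (\<Sum>i<p. ?Y ^ (p - Suc i) * ?X ^ i)"
    by (simp add: dvd_diff_left_iff)
  with Suc.IH have "of_nat p ^ (s + M) * of_nat p dvd (?X - ?Y) * (\<Sum>i<p. ?Y ^ (p - Suc i) * ?X ^ i)"
    by (rule mult_dvd_mono)
  moreover have "z ^ (p ^ Suc M) = (z ^ (p ^ M)) ^ p" for z :: 'a
    by (simp only: power_Suc2 power_mult)
  ultimately show ?case
    by (simp only: power_diff_sumr2[of ?X p ?Y, symmetric] power_Suc2 add_Suc_right)
qed (use assms in simp)

lemma power_diff_dvd_step:
  fixes x y :: int
  assumes "prime p" "odd p" "int p dvd x - y" "\<not> int p dvd y" "int p ^ Suc s dvd x ^ p - y ^ p"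
  shows "int p ^ s dvd x - y"
proof -
  have p2: "p > 2" using assms(1,2) prime_ge_2_nat[of p] by (cases "p = 2") auto
  obtain z where z: "x = y + int p * z" using assms(3) by (metis diff_add_cancel add.commute dvdE)
  have lin: "[y ^ (p - Suc i) * x ^ i = y ^ (p - 1) + int i * (int p * z * y ^ (p - 2))] (mod (int p ^ 2))"
    if "i < p" for i
  proof (cases i)
    case (Suc j)
    have "[x ^ i = y ^ i + int i * (int p * z * y ^ (i - 1))] (mod (int p ^ 2))" for i
    proof (induction i)
      case (Suc i)
      have "[x ^ Suc i = (y ^ i + int i * (int p * z * y ^ (i - 1))) * (y + int p * z)] (mod (int p ^ 2))"
        using cong_mult[OF Suc cong_refl[of x]] by (simp add: z mult.commute)
      also have "(y ^ i + int i * (int p * z * y ^ (i - 1))) * (y + int p * z)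
         = y ^ Suc i + int (Suc i) * (int p * z * y ^ (Suc i - 1)) + int p ^ 2 * (int i * z ^ 2 * y ^ (i - 1))"
        by (cases i) (simp_all add: algebra_simps power2_eq_square)
      also have "[\<dots> = y ^ Suc i + int (Suc i) * (int p * z * y ^ (Suc i - 1))] (mod (int p ^ 2))"
        by (simp add: cong_iff_dvd_diff)
      finally show ?case .
    qed simp
    from cong_mult[OF cong_refl[of "y ^ (p - Suc i)"] this[of i]]
    have "[y ^ (p - Suc i) * x ^ i =
       y ^ (p - Suc i) * (y ^ i + int i * (int p * z * y ^ (i - 1)))] (mod (int p ^ 2))" .
    moreover have "y ^ (p - Suc i) * y ^ i = y ^ (p - 1)" "y ^ (p - Suc i) * y ^ (i - 1) = y ^ (p - 2)"
    proof -
      have "p - Suc i + i = p - 1" "p - Suc i + (i - 1) = p - 2" using that Suc by auto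
      thus "y ^ (p - Suc i) * y ^ i = y ^ (p - 1)" "y ^ (p - Suc i) * y ^ (i - 1) = y ^ (p - 2)"
        by (metis power_add)+
    qed
    ultimately show ?thesis by (simp add: algebra_simps)
  qed simp
  have "[(\<Sum>i<p. y ^ (p - Suc i) * x ^ i)
     = (\<Sum>i<p. y ^ (p - 1) + int i * (int p * z * y ^ (p - 2)))] (mod (int p ^ 2))"
    by (rule cong_sum) (use lin in auto)
  also have "(\<Sum>i<p. y ^ (p - 1) + int i * (int p * z * y ^ (p - 2)))
     = int p * y ^ (p - 1) + (\<Sum>i<p. int i) * (int p * z * y ^ (p - 2))"
    by (simp add: sum.distrib sum_distrib_right)
  also have "(\<Sum>i<p. int i) = int p * int ((p - 1) div 2)"
  proof -
    have "2 * (\<Sum>i<n. int i) = int n * (int n - 1)" for n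
      by (induction n) (auto simp: algebra_simps)
    from this[of p] have "2 * (\<Sum>i<p. int i) = 2 * (int p * int ((p - 1) div 2))"
      using assms(2) p2 by (auto elim!: oddE)
    thus ?thesis by simp
  qed
  also have "[int p * y ^ (p - 1) + int p * int ((p - 1) div 2) * (int p * z * y ^ (p - 2))
      = int p * y ^ (p - 1)] (mod (int p ^ 2))"
    by (simp add: cong_iff_dvd_diff power2_eq_square)
  finally have "int p ^ 2 dvd (\<Sum>i<p. y ^ (p - Suc i) * x ^ i) - int p * y ^ (p - 1)"
    by (simp add: cong_iff_dvd_diff)
  then obtain w where "(\<Sum>i<p. y ^ (p - Suc i) * x ^ i) - int p * y ^ (p - 1) = int p ^ 2 * w" ..
  hence w: "(\<Sum>i<p. y ^ (p - Suc i) * x ^ i) = int p * (y ^ (p - 1) + int p * w)"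
    by (simp add: algebra_simps power2_eq_square)
  have "\<not> int p dvd y ^ (p - 1)"
    using assms(1,4) by (meson prime_dvd_power prime_nat_int_transfer)
  hence "\<not> int p dvd y ^ (p - 1) + int p * w"
    by (simp add: dvd_add_left_iff)
  hence cop: "coprime (int p ^ s) (y ^ (p - 1) + int p * w)"
    using assms(1) by (simp add: prime_imp_coprime)
  have "int p ^ Suc s dvd (x - y) * (int p * (y ^ (p - 1) + int p * w))"
    using assms(5) w by (simp add: power_diff_sumr2)
  hence "int p ^ s dvd (x - y) * (y ^ (p - 1) + int p * w)"
    using p2 by (simp add: mult.left_commute)
  thus ?thesis using cop by (simp add: coprime_dvd_mult_left_iff)
qed

lemma power_diff_dvd:
  fixes x y :: int
  assumes "prime p" "odd p" "int p dvd x - y" "\<not> int p dvd y"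
  shows "int p ^ (M + s) dvd x ^ (p ^ M) - y ^ (p ^ M) \<longleftrightarrow> (int p ^ s dvd x - y)"
proof
  assume "int p ^ (M + s) dvd x ^ (p ^ M) - y ^ (p ^ M)"
  thus "int p ^ s dvd x - y"
  proof (induction M)
    case (Suc M)
    have "int p dvd x ^ (p ^ M) - y ^ (p ^ M)"
      by (metis assms(3) dvd_mult2 power_diff_sumr2)
    moreover have "\<not> int p dvd y ^ (p ^ M)"
      using assms(1,4) by (meson prime_dvd_power prime_nat_int_transfer)
    moreover have "int p ^ Suc (M + s) dvd (x ^ (p ^ M)) ^ p - (y ^ (p ^ M)) ^ p"
      using Suc.prems by (simp add: power_mult[symmetric] mult.commute)
    ultimately show ?case using power_diff_dvd_step[OF assms(1,2)] Suc.IH by blast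
  qed simp
next
  assume a: "int p ^ s dvd x - y"
  show "int p ^ (M + s) dvd x ^ (p ^ M) - y ^ (p ^ M)"
  proof (cases "s = 0")
    case True
    have "int p ^ (1 + M) dvd x ^ (p ^ M) - y ^ (p ^ M)"
      using dvd_power_diff[of p 1 x y M] assms(3) by simp
    thus ?thesis using True power_le_dvd[of "int p" "1+M"] by simp
  next
    case False
    thus ?thesis using dvd_power_diff[of p s x y M] a by (simp add: add.commute)
  qed
qed

lemma ee_add: "ee (x + y) = ee x * ee y"
  by (simp add: ee_def exp_add[symmetric] algebra_simps)

lemma norm_ee [simp]: "norm (ee x) = 1"
  by (simp add: ee_def)

lemma cnj_ee: "cnj (ee x) = ee (- x)"
  by (simp add: ee_def exp_cnj)

lemma ee_power: "ee x ^ n = ee (real n * x)"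
  by (simp add: ee_def exp_of_nat_mult[symmetric] algebra_simps)

lemma ee_eq_1_iff: "ee x = 1 \<longleftrightarrow> x \<in> \<int>"
proof -
  have "ee x = 1 \<longleftrightarrow> (\<exists>n::int. 2 * pi * x = of_int (2 * n) * pi)"
    by (simp add: ee_def exp_eq_1)
  also have "\<dots> \<longleftrightarrow> x \<in> \<int>"
    by (auto simp: Ints_def)
  finally show ?thesis .
qed

lemma ee_divide_eq_1_iff:
  assumes "N > 0"
  shows "ee (of_int a / of_nat N) = 1 \<longleftrightarrow> int N dvd a"
proof
  assume "ee (of_int a / of_nat N) = 1"
  then obtain n where "of_int a / real N = of_int n"
    by (auto simp: ee_eq_1_iff Ints_def)
  hence "real_of_int a = real_of_int (n * int N)" using assms by (simp add: field_simps)
  hence "a = n * int N" by (simp only: of_int_eq_iff)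
  thus "int N dvd a" by simp
qed (use assms in \<open>auto simp: ee_eq_1_iff\<close>)

lemma ee_cong:
  assumes "[a = b] (mod int N)" "N > 0"
  shows "ee (of_int a / of_nat N) = ee (of_int b / of_nat N)"
proof -
  have "ee (of_int a / of_nat N) = ee (of_int b / of_nat N + of_int (a - b) / of_nat N)"
    by (simp add: diff_divide_distrib)
  also have "\<dots> = ee (of_int b / of_nat N) * ee (of_int (a - b) / of_nat N)"
    by (rule ee_add)
  also have "ee (of_int (a - b) / of_nat N) = 1"
    using assms by (subst ee_divide_eq_1_iff) (auto simp: cong_iff_dvd_diff)
  finally show ?thesis by simp
qed

lemma dirichlet_char_cong:
  assumes "dirichlet_char N chi" "[a = b] (mod int N)"
  shows "chi a = chi b"
proof -
  have per: "chi (x + int N * int j) = chi x" for x j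
  proof (induction j)
    case (Suc j)
    have "chi (x + int N * int (Suc j)) = chi ((x + int N * int j) + int N)"
      by (simp add: algebra_simps)
    thus ?case using Suc assms(1) by (simp add: dirichlet_char_def)
  qed simp
  obtain k where k: "a = b + int N * k" using assms(2) by (metis cong_iff_lin cong_sym)
  show ?thesis
  proof (cases "k \<ge> 0")
    case True thus ?thesis using per[of b "nat k"] k by simp
  next
    case False thus ?thesis using per[of a "nat (- k)"] k by simp
  qed
qed

lemma dirichlet_char_mult: "dirichlet_char N chi \<Longrightarrow> chi (a * b) = chi a * chi b"
  by (simp add: dirichlet_char_def)

lemma dirichlet_char_power: "dirichlet_char N chi \<Longrightarrow> chi (a ^ n) = chi a ^ n"
  by (induction n) (simp_all add: dirichlet_char_def)

lemma norm_dirichlet_char: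
  assumes "dirichlet_char N chi" "coprime a (int N)"
  shows "norm (chi a) = 1"
proof -
  have N: "N > 0" using assms(1) by (simp add: dirichlet_char_def)
  have "chi x \<in> chi ` {0..<int N}" for x
    using N by (intro image_eqI[of _ _ "x mod int N"] dirichlet_char_cong[OF assms(1)]) (auto simp: cong_def)
  hence "range (\<lambda>i. chi (a ^ i)) \<subseteq> chi ` {0..<int N}" by blast
  hence "finite (range (\<lambda>i::nat. chi (a ^ i)))" using finite_subset by blast
  hence "\<not> inj (\<lambda>i::nat. chi (a ^ i))" using finite_imageD by blast
  then obtain i j where ij: "i < j" "chi a ^ i = chi a ^ j"
    unfolding inj_def dirichlet_char_power[OF assms(1)] by (metis linorder_neqE_nat)
  have nz: "chi a \<noteq> 0" using assms by (simp add: dirichlet_char_def)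
  obtain d where d: "d > 0" "j = i + d" using ij(1) less_imp_add_positive by auto
  hence "chi a ^ d = 1" using ij(2) nz by (simp add: power_add)
  thus ?thesis using d(1) power_eq_1_iff by blast
qed

lemma primitive_char_log:
  fixes p m M :: nat
  assumes "prime p" "odd p" "m \<ge> 2" "M \<ge> m" "primitive_char (p ^ m) chi"
  obtains C :: int where "1 \<le> C" "C \<le> int p ^ (m - 1)" "\<not> int p dvd C"
    "\<And>u. [u = 1] (mod int p) \<Longrightarrow>
       chi u = ee (of_int (C * (u ^ (p ^ M) - 1)) / of_nat (p ^ (M + m)))"
proof -
  define P where "P = p ^ M"
  have p2: "p > 2" using assms(1,2) prime_ge_2_nat[of p] by (cases "p = 2") auto
  have dc: "dirichlet_char (p ^ m) chi" using assms(5) by (simp add: primitive_char_def)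
  have m: "m = Suc (m - 1)" using assms(3) by simp
  have nd1: "\<not> int p dvd y" if "[y = 1] (mod int p)" for y
    using that p2 by (metis cong_dvd_iff int_dvd_int_iff nat_dvd_1_iff_1 of_nat_1 not_numeral_less_one)
  have lte: "int p ^ (M + s) dvd x ^ P - y ^ P \<longleftrightarrow> int p ^ s dvd x - y"
    if "[x = 1] (mod int p)" "[y = 1] (mod int p)" for x y s
    unfolding P_def using power_diff_dvd[OF assms(1,2), of x y M s] that nd1[OF that(2)]
      cong_trans[OF that(1) cong_sym[OF that(2)]] by (simp add: cong_iff_dvd_diff)
  define L where "L = (\<lambda>u::int. (u ^ P - 1) div int p ^ (M + 1))"
  have L: "u ^ P = 1 + int p ^ (M + 1) * L u" if "[u = 1] (mod int p)" for u
    using lte[of u 1 1] that by (simp add: L_def cong_iff_dvd_diff)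
  have one: "[1 + int p * z = 1] (mod int p)" for z by (simp add: cong_iff_dvd_diff)
  have Linj: "[u = v] (mod int p ^ m)"
    if "[u = 1] (mod int p)" "[v = 1] (mod int p)" "[L u = L v] (mod int p ^ (m - 1))" for u v
  proof -
    have "u ^ P - v ^ P = int p ^ (M + 1) * (L u - L v)"
      using L[OF that(1)] L[OF that(2)] by (simp add: algebra_simps)
    moreover have "int p ^ (M + m) = int p ^ (M + 1) * int p ^ (m - 1)"
      using assms(3) by (simp only: power_add[symmetric]) simp
    ultimately have "int p ^ (M + m) dvd u ^ P - v ^ P"
      using that(3) by (simp add: cong_iff_dvd_diff)
    thus ?thesis using lte[OF that(1,2)] by (simp add: cong_iff_dvd_diff)
  qed
  obtain u0 where u0: "[u0 = 1] (mod int p)" "[L u0 = 1] (mod int p ^ (m - 1))"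
  proof -
    define f where "f = (\<lambda>z::int. L (1 + int p * z) mod int p ^ (m - 1))"
    let ?I = "{0..<int p ^ (m - 1)}"
    have pos: "int p ^ (m - 1) > 1" using p2 assms(3) by (intro one_less_power) auto
    have "inj_on f ?I"
    proof (rule inj_onI)
      fix z z' assume z: "z \<in> ?I" "z' \<in> ?I" and eq: "f z = f z'"
      have "[1 + int p * z = 1 + int p * z'] (mod int p * int p ^ (m - 1))"
        using Linj[OF one one, of z z'] eq m by (simp add: f_def cong_def flip: power_Suc)
      hence "[z = z'] (mod int p ^ (m - 1))"
        using p2 by (simp add: cong_iff_dvd_diff flip: right_diff_distrib)
      thus "z = z'" using z by (simp add: cong_def)
    qed
    moreover have "f ` ?I \<subseteq> ?I" using p2 by (auto simp: f_def intro!: pos_mod_sign pos_mod_bound)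
    ultimately have "f ` ?I = ?I" by (simp add: endo_inj_surj)
    hence "1 \<in> f ` ?I" using pos by simp
    then obtain z where "f z = 1" by auto
    with that[OF one] pos show ?thesis by (simp add: f_def cong_def)
  qed
  have "[u0 ^ (p ^ (m - 1)) = 1] (mod int p ^ m)"
    using dvd_power_diff[of p 1 u0 1 "m - 1"] u0(1) m by (simp add: cong_iff_dvd_diff)
  hence "chi (u0 ^ (p ^ (m - 1))) = chi 1" by (intro dirichlet_char_cong[OF dc]) simp
  hence "chi u0 ^ (p ^ (m - 1)) = 1"
    using dc by (simp add: dirichlet_char_power[OF dc]) (simp add: dirichlet_char_def)
  hence "chi u0 \<in> {exp(2 * of_real pi * \<i> * of_nat j / of_nat (p ^ (m - 1))) | j. j < p ^ (m - 1)}"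
    using p2 by (subst complex_roots_unity[symmetric]) auto
  then obtain j where j: "j < p ^ (m - 1)" "chi u0 = ee (real j / real (p ^ (m - 1)))"
    by (auto simp: ee_def)
  have main: "chi u = ee (of_int (int j * (u ^ P - 1)) / of_nat (p ^ (M + m)))"
    if u: "[u = 1] (mod int p)" for u
  proof -
    define t where "t = nat (L u mod int p ^ (m - 1))"
    have pos: "int p ^ (m - 1) > 0" using p2 by simp
    have t: "[L u = int t] (mod int p ^ (m - 1))" using pos by (simp add: t_def cong_def)
    have u0t: "[u0 ^ t = 1] (mod int p)" using cong_pow[OF u0(1), of t] by simp
    have "[L (u0 ^ t) = int t * L u0] (mod int p ^ (m - 1))"
    proof (induction t)
      case 0 show ?case using L[of 1] by (simp add: L_def)
    next
      case (Suc t)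
      have "[u0 ^ t = 1] (mod int p)" for t using cong_pow[OF u0(1), of t] by simp
      note Lt = L[OF this]
      have "int p ^ (M + 1) * L (u0 ^ Suc t) = u0 ^ P * (u0 ^ t) ^ P - 1"
        using Lt[of "Suc t"] by (simp add: power_mult_distrib)
      also have "\<dots> = int p ^ (M + 1) * (L u0 + L (u0 ^ t) + int p ^ (M + 1) * L u0 * L (u0 ^ t))"
        unfolding L[OF u0(1)] Lt by (simp add: algebra_simps)
      finally have "L (u0 ^ Suc t) = L u0 + L (u0 ^ t) + int p ^ (M + 1) * L u0 * L (u0 ^ t)"
        using p2 by simp
      moreover have "int p ^ (m - 1) dvd int p ^ (M + 1)"
        using assms(4) by (intro le_imp_power_dvd) auto
      ultimately have "[L (u0 ^ Suc t) = L u0 + L (u0 ^ t)] (mod int p ^ (m - 1))"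
        by (auto simp: cong_iff_dvd_diff)
      from cong_trans[OF this cong_add[OF cong_refl Suc]] show ?case by (simp add: algebra_simps)
    qed
    also have "[int t * L u0 = int t * 1] (mod int p ^ (m - 1))"
      by (intro cong_mult cong_refl u0(2))
    finally have "[L (u0 ^ t) = L u] (mod int p ^ (m - 1))" using cong_trans[OF _ cong_sym[OF t]] by simp
    hence "[u0 ^ t = u] (mod int (p ^ m))" using Linj[OF u0t u] by simp
    hence "chi u = chi u0 ^ t"
      using dirichlet_char_cong[OF dc] dirichlet_char_power[OF dc] by metis
    also have "\<dots> = ee (of_int (int j * int t) / of_nat (p ^ (m - 1)))"
      by (simp add: j(2) ee_power mult_ac)
    also have "\<dots> = ee (of_int (int j * L u) / of_nat (p ^ (m - 1)))"
      using p2 t by (intro ee_cong cong_mult cong_refl) (auto simp: cong_sym)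
    also have "of_int (int j * L u) / of_nat (p ^ (m - 1))
        = of_int (int j * (u ^ P - 1)) / real (p ^ (M + m))"
    proof -
      have "real (p ^ (M + m)) = real p ^ (M + 1) * real p ^ (m - 1)"
        using assms(3) by (simp only: power_add[symmetric] of_nat_power) simp
      thus ?thesis using p2 L[OF u] by simp
    qed
    finally show ?thesis .
  qed
  have nd: "\<not> int p dvd int j"
  proof
    assume "int p dvd int j"
    have "p ^ (m - 1) dvd p ^ m \<and> p ^ (m - 1) < p ^ m"
      using p2 assms(3) by (auto intro: le_imp_power_dvd power_strict_increasing)
    then obtain a where a: "[a = 1] (mod int (p ^ (m - 1)))" "chi a \<noteq> 1"
      using assms(5) unfolding primitive_char_def by blast
    have a1: "[a = 1] (mod int p)"
      using a(1) assms(3) by (auto simp: cong_iff_dvd_diff elim!: dvd_trans[rotated] intro!: dvd_power)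
    have "int p ^ (M + (m - 1)) dvd a ^ P - 1"
      using lte[OF a1, of 1 "m - 1"] a(1) by (simp add: cong_iff_dvd_diff)
    with \<open>int p dvd int j\<close> have "int p * int p ^ (M + (m - 1)) dvd int j * (a ^ P - 1)"
      by (rule mult_dvd_mono)
    hence "int (p ^ (M + m)) dvd int j * (a ^ P - 1)" using m by (metis add_Suc_right of_nat_power power_Suc)
    hence "chi a = 1" using main[OF a1] p2 by (simp add: ee_divide_eq_1_iff del: of_nat_power of_int_mult)
    with a(2) show False by simp
  qed
  show ?thesis
  proof (rule that[of "int j"])
    show "1 \<le> int j" using nd by (cases j) auto
    show "int j \<le> int p ^ (m - 1)" using j(1) by (metis less_imp_le of_nat_le_iff of_nat_power)
  qed (use nd main P_def in auto)
qed

lemma prime_power_dvd_mult_cancel: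
  fixes x y :: int
  assumes "prime p" "\<not> int p ^ Suc v dvd x" "int p ^ r dvd x * y"
  shows "int p ^ (r - v) dvd y"
proof -
  obtain i j where ij: "i + j = r" "int p ^ i dvd x" "int p ^ j dvd y"
    using prime_elem_power_dvd_prod[OF assms(3)] assms(1) by (auto simp: prime_nat_int_transfer)
  have "i \<le> v"
    using assms(2) ij(2) by (meson not_less_eq_eq power_le_dvd)
  thus ?thesis using ij by (intro power_le_dvd[OF ij(3)]) simp
qed

text \<open>Dividing by one factor \<open>x - a0\<close> at a time costs at most \<open>p^(e-1)\<close> in the modulus.\<close>

lemma roots_mod_prime_power_bound:
  fixes P :: "int poly"
  assumes "prime p" "finite A"
    and "\<And>a b. a \<in> A \<Longrightarrow> b \<in> A \<Longrightarrow> a \<noteq> b \<Longrightarrow> \<not> int p ^ Suc e dvd a - b"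
    and "\<And>a. a \<in> A \<Longrightarrow> int p ^ r dvd poly P a"
    and "\<not> int p dvd coeff P D" "\<And>i. i > D \<Longrightarrow> int p dvd coeff P i" "D * e < r"
  shows "card A \<le> D"
proof (rule ccontr)
  assume "\<not> card A \<le> D"
  hence "Suc D \<le> card A" by simp
  then obtain B where "B \<subseteq> A" "card B = Suc D"
    by (rule obtain_subset_with_card_n) blast
  hence "card B = Suc D" "\<And>a b. a \<in> B \<Longrightarrow> b \<in> B \<Longrightarrow> a \<noteq> b \<Longrightarrow> \<not> int p ^ Suc e dvd a - b"
    "\<And>a. a \<in> B \<Longrightarrow> int p ^ r dvd poly P a"
    using assms(3,4) by blast+
  thus False using assms(5-7)
  proof (induction D arbitrary: P B r)
    case 0
    then obtain a where a: "a \<in> B" by (metis card_eq_SucD insertI1)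
    have "int p dvd coeff (P - [:coeff P 0:]) i" for i
      using "0.prems"(5)[of i] by (cases i) auto
    hence "[:int p:] dvd P - [:coeff P 0:]" by (simp add: const_poly_dvd_iff)
    then obtain Q where "P - [:coeff P 0:] = [:int p:] * Q" ..
    from arg_cong[OF this, of "\<lambda>q. poly q a"]
    have "poly P a = coeff P 0 + int p * poly Q a" by (simp add: algebra_simps)
    moreover have "int p dvd poly P a"
      using "0.prems"(3)[OF a] "0.prems"(6) by (metis dvd_power dvd_trans mult_0)
    ultimately show False using "0.prems"(4) by (simp add: dvd_add_left_iff)
  next
    case (Suc D)
    then obtain a where a: "a \<in> B" by (metis card_eq_SucD insertI1)
    define Q where "Q = synthetic_div P a"
    have eq: "P + smult a Q = pCons (poly P a) Q"
      unfolding Q_def by (rule synthetic_div_correct)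
    have Qc: "coeff Q i = coeff P (Suc i) + a * coeff Q (Suc i)" for i
      using arg_cong[OF eq, of "\<lambda>q. coeff q (Suc i)"] by simp
    have high: "int p dvd coeff Q i" if "i > D" for i
    proof (cases "i \<le> degree Q")
      case True
      thus ?thesis using that
      proof (induction i rule: inc_induct)
        case base
        thus ?case using Suc.prems(5)[of "Suc (degree Q)"] Qc[of "degree Q"] by (simp add: coeff_eq_0)
      next
        case (step i)
        thus ?case using Suc.prems(5)[of "Suc i"] Qc[of i] by simp
      qed
    qed (simp add: coeff_eq_0)
    have low: "\<not> int p dvd coeff Q D"
      using Suc.prems(4) high[of "Suc D"] Qc[of D] by (simp add: dvd_add_left_iff)
    have "int p ^ (r - e) dvd poly Q b" if b: "b \<in> B - {a}" for b
    proof -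
      have "poly P b = (b - a) * poly Q b + poly P a"
        using arg_cong[OF eq, of "\<lambda>q. poly q b"] by (simp add: algebra_simps)
      hence "int p ^ r dvd (b - a) * poly Q b"
        using Suc.prems(3)[OF a] Suc.prems(3)[of b] b by (metis DiffD1 dvd_add_left_iff)
      thus ?thesis using prime_power_dvd_mult_cancel[OF assms(1)] Suc.prems(2)[of b a] a b by auto
    qed
    moreover have "card (B - {a}) = Suc D" using Suc.prems(1) a by (simp add: card_Diff_singleton)
    moreover have "D * e < r - e" using Suc.prems(6) by simp
    ultimately show False
      using Suc.IH[of "B - {a}" "r - e" Q] Suc.prems(2) low high by blast
  qed
qed

lemma multiplicity_bounds:
  fixes p j v :: nat
  assumes "p \<ge> 3" "p ^ v dvd j" "j \<ge> 2"
  shows "v \<le> j - 2" "2 * v \<le> j"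
proof -
  have "3 ^ v \<le> p ^ v" using assms(1) by (simp add: power_mono)
  also have "p ^ v \<le> j" using assms by (intro dvd_imp_le) auto
  finally have *: "3 ^ v \<le> j" .
  have "v + 2 \<le> 3 ^ v" if "v \<ge> 1" using that by (induction v rule: dec_induct) auto
  moreover have "2 * v + 1 \<le> 3 ^ v" by (induction v) auto
  ultimately show "v \<le> j - 2" "2 * v \<le> j" using * assms(3) by (cases "v = 0"; simp)+
qed

text \<open>The Taylor coefficient of index \<open>j\<close> is \<open>coeff (pderiv T) (j - 1) / j\<close>. For small \<open>j\<close> the first
  decomposition of \<open>J\<close> makes up for the denominator \<open>j\<close>, and for large \<open>j\<close> the
  factor \<open>p^j\<close> alone does.\<close>

lemma poly_linear_approx:
  fixes T J E Z :: "int poly" and p k t m M :: nat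
  assumes "prime p" "odd p" "k \<ge> 1" "m \<le> 2 * k + t" "t \<le> m" "3 * m \<le> M"
    and T: "pderiv T = smult (int p ^ M) J"
    and J: "J = smult (int p ^ Suc t) E + smult (int p ^ M) Z"
    and J': "\<And>i. int p ^ Suc i dvd coeff J i" and E: "\<And>i. int p ^ i dvd coeff E i"
  shows "int p ^ (M + m) dvd
    poly T (int p ^ (k - 1) * b) - poly T 0 - int p ^ (k - 1) * b * coeff (pderiv T) 0"
proof -
  have p3: "p \<ge> 3" using assms(1,2) prime_ge_2_nat[of p] by (cases "p = 2") auto
  define x where "x = int p ^ (k - 1) * b"
  have taylor_term: "int p ^ (M + m) dvd coeff T j * x ^ j" if j: "j \<ge> 2" for j
  proof -
    define v where "v = multiplicity p j"
    have v: "v \<le> j - 2" "2 * v \<le> j"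
      using multiplicity_bounds[OF p3 multiplicity_dvd j] by (simp_all add: v_def)
    have "\<not> p ^ Suc v dvd j"
      unfolding v_def using j p3 by (subst power_dvd_iff_le_multiplicity) auto
    hence nv: "\<not> int p ^ Suc v dvd int j"
      by (metis int_dvd_int_iff of_nat_power)
    have cj: "coeff (pderiv T) (j - 1) = int j * coeff T j"
      using j by (simp add: coeff_pderiv)
    have xj: "int p ^ ((k - 1) * j) dvd x ^ j"
      by (simp add: x_def power_mult_distrib power_mult)
    obtain s where s: "int p ^ s dvd coeff T j" "M + m \<le> s + (k - 1) * j"
    proof (cases "t + j \<le> M")
      case True
      have "int p ^ (Suc t + (j - 1)) dvd int p ^ Suc t * coeff E (j - 1)"
        unfolding power_add by (intro mult_dvd_mono E) simp
      moreover have "int p ^ (Suc t + (j - 1)) dvd int p ^ M * coeff Z (j - 1)"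
        using True j by (intro dvd_mult2 le_imp_power_dvd) simp
      ultimately have "int p ^ (t + j) dvd coeff J (j - 1)"
        using j unfolding J by simp
      hence "int p ^ (M + (t + j)) dvd int j * coeff T j"
        unfolding cj[symmetric] T by (simp add: power_add)
      from prime_power_dvd_mult_cancel[OF assms(1) nv this]
      have "int p ^ (M + (t + j) - v) dvd coeff T j" .
      moreover have "2 * (k - 1) \<le> (k - 1) * j" using j by simp
      hence "M + m \<le> M + (t + j) - v + (k - 1) * j" using v(1) j assms(3,4) by linarith
      ultimately show ?thesis using that by blast
    next
      case False
      have "int p ^ j dvd coeff J (j - 1)" using J'[of "j - 1"] j by simp
      hence "int p ^ (M + j) dvd int j * coeff T j"
        unfolding cj[symmetric] T by (simp add: power_add)
      from prime_power_dvd_mult_cancel[OF assms(1) nv this]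
      have "int p ^ (M + j - v) dvd coeff T j" .
      moreover have "M + m \<le> M + j - v + (k - 1) * j" using False v(2) assms(5,6) by linarith
      ultimately show ?thesis using that by blast
    qed
    have "int p ^ (s + (k - 1) * j) dvd coeff T j * x ^ j"
      unfolding power_add by (intro mult_dvd_mono s xj)
    thus ?thesis using s(2) power_le_dvd by blast
  qed
  obtain c0 c1 T2 where T2: "T = pCons c0 (pCons c1 T2)" by (metis pCons_cases)
  have "poly T x - poly T 0 - x * coeff (pderiv T) 0 = x ^ 2 * poly T2 x"
    by (simp add: T2 coeff_pderiv power2_eq_square algebra_simps)
  also have "\<dots> = (\<Sum>i\<le>degree T2. coeff T (i + 2) * x ^ (i + 2))"
    by (simp add: T2 poly_altdef sum_distrib_left power_add power2_eq_square mult_ac)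
  also have "int p ^ (M + m) dvd \<dots>" by (intro dvd_sum taylor_term) simp
  finally show ?thesis by (simp add: x_def)
qed

lemma prime_elem_power_factor:
  fixes q :: "'a::algebraic_semidom"
  assumes "prime_elem q" "W * X = q ^ n * U"
  shows "\<exists>i V Y. i \<le> n \<and> W = q ^ i * V \<and> V * Y = U"
proof -
  obtain i j where ij: "i + j = n" "q ^ i dvd W" "q ^ j dvd X"
    using prime_elem_power_dvd_prod[of q n W X] assms by auto
  obtain V where V: "W = q ^ i * V" using ij(2) ..
  obtain Y where Y: "X = q ^ j * Y" using ij(3) ..
  have "q ^ n * (V * Y) = q ^ n * U"
    using assms(2) by (simp add: V Y ij(1)[symmetric] power_add mult_ac)
  hence "V * Y = U" using assms(1) by (simp add: prime_elem_def)
  thus ?thesis using ij(1) V by (intro exI[of _ i]) auto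
qed

lemma phase_poly_deriv:
  fixes A B G K :: "int poly" and p n M :: nat and C :: int
  assumes "[:int p:] dvd A - 1" "[:int p:] dvd B - 1" "[:int p:] dvd G - 1"
    and n: "p ^ M = Suc (Suc n)"
  defines "T \<equiv> smult (int p ^ M) (K * G ^ Suc n) + smult C (A ^ (p ^ M) - B ^ (p ^ M))"
  defines "J \<equiv> pderiv K * G ^ Suc n + of_nat (Suc n) * K * G ^ n * pderiv G
     + smult C (A ^ Suc n * pderiv A - B ^ Suc n * pderiv B)"
  defines "N \<equiv> (pderiv K * G - K * pderiv G) * A * B
     + smult C ((pderiv A * B - pderiv B * A) * G ^ 2)"
  shows "pderiv T = smult (int p ^ M) J"
    and "\<exists>Z. J = (G ^ 2 * A * B) ^ Suc n * N + smult (int p ^ M) Z"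
proof -
  define q :: "int poly" where "q = [:int p ^ M:]"
  have pM: "int p ^ M = int (Suc (Suc n))" by (metis n of_nat_power)
  have "q = of_nat (Suc (Suc n))" unfolding q_def pM of_nat_poly ..
  hence q: "q = of_nat (Suc n) + 1" by simp
  from pM show "pderiv T = smult (int p ^ M) J"
    unfolding T_def J_def n pderiv_add pderiv_smult pderiv_diff pderiv_mult pderiv_power_Suc
    by (simp add: of_nat_poly algebra_simps smult_diff_right smult_add_right)
  have pow: "\<exists>Z. X ^ Suc n * X = 1 + q * Z" if "[:int p:] dvd X - 1" for X
  proof -
    have "q dvd of_nat p ^ (1 + M)"
      by (simp add: q_def of_nat_poly poly_const_pow)
    also have "of_nat p ^ (1 + M) dvd X ^ (p ^ M) - 1 ^ (p ^ M)"
      using that by (intro dvd_power_diff) (simp_all add: of_nat_poly)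
    finally obtain Z where "X ^ (p ^ M) - 1 = q * Z" by auto
    thus ?thesis using n by (intro exI[of _ Z]) (simp add: algebra_simps)
  qed
  obtain ZA ZB ZG where Z: "A ^ Suc n * A = 1 + q * ZA" "B ^ Suc n * B = 1 + q * ZB"
    "G ^ Suc n * G = 1 + q * ZG" using pow assms(1-3) by meson
  define U where "U = G ^ 2 * A * B"
  have "[:int p:] dvd (G - 1) * (G * A * B) + (G - 1) * (A * B) + (A - 1) * B + (B - 1)"
    using assms(1-3) by (intro dvd_add dvd_mult2)
  also have "\<dots> = U - 1" by (simp add: U_def power2_eq_square algebra_simps)
  finally obtain ZU where ZU: "U ^ Suc n * U = 1 + q * ZU" using pow by blast
  define Z1 where "Z1 = pderiv K * A * B * G * ZG + K * pderiv G * A * B * (1 + q * ZG) - K * pderiv G * A * B * ZG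
     + smult C ((pderiv A * B * ZA - pderiv B * A * ZB) * G ^ 2)"
  have "J * U = pderiv K * A * B * G * (G ^ Suc n * G)
     + of_nat (Suc n) * K * pderiv G * A * B * (G ^ Suc n * G)
     + smult C ((pderiv A * B * (A ^ Suc n * A) - pderiv B * A * (B ^ Suc n * B)) * G ^ 2)"
    unfolding J_def U_def by (simp add: power2_eq_square algebra_simps smult_add_right smult_diff_right)
  also have "of_nat (Suc n) = q - 1" using q by simp
  finally have "J * U = N + q * Z1"
    unfolding Z N_def Z1_def by (simp add: algebra_simps smult_add_right smult_diff_right)
  hence "U ^ Suc n * (J * U) = U ^ Suc n * (N + q * Z1)" by simp
  moreover have "U ^ Suc n * (J * U) = J * (1 + q * ZU)" unfolding ZU[symmetric] by (simp only: mult_ac)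
  ultimately have "J = U ^ Suc n * N + q * (U ^ Suc n * Z1 - J * ZU)"
    by (simp add: algebra_simps)
  thus "\<exists>Z. J = (G ^ 2 * A * B) ^ Suc n * N + smult (int p ^ M) Z"
    unfolding U_def q_def by (intro exI) simp
qed

definition padic_scaled :: "nat \<Rightarrow> int poly \<Rightarrow> bool" where
  "padic_scaled p q \<longleftrightarrow> (\<forall>i. int p ^ i dvd coeff q i)"

lemma padic_scaled_add: "padic_scaled p x \<Longrightarrow> padic_scaled p y \<Longrightarrow> padic_scaled p (x + y)"
  by (simp add: padic_scaled_def)

lemma padic_scaled_diff: "padic_scaled p x \<Longrightarrow> padic_scaled p y \<Longrightarrow> padic_scaled p (x - y)"
  by (simp add: padic_scaled_def)

lemma padic_scaled_smult: "padic_scaled p x \<Longrightarrow> padic_scaled p (smult c x)"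
  by (simp add: padic_scaled_def)

lemma padic_scaled_const: "padic_scaled p [:c:]"
  by (auto simp: padic_scaled_def coeff_pCons split: nat.splits)

lemma padic_scaled_mult:
  assumes "padic_scaled p x" "padic_scaled p y"
  shows "padic_scaled p (x * y)"
  unfolding padic_scaled_def coeff_mult
proof (intro allI dvd_sum)
  fix n i :: nat assume "i \<in> {..n}"
  hence "int p ^ n = int p ^ i * int p ^ (n - i)" by (simp flip: power_add)
  also have "\<dots> dvd coeff x i * coeff y (n - i)"
    using assms by (intro mult_dvd_mono) (auto simp: padic_scaled_def)
  finally show "int p ^ n dvd coeff x i * coeff y (n - i)" .
qed

lemma padic_scaled_power: "padic_scaled p x \<Longrightarrow> padic_scaled p (x ^ n)"
proof (induction n)
  case 0 show ?case using padic_scaled_const[of p 1] by (simp add: one_pCons)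
qed (simp add: padic_scaled_mult)

lemma padic_scaled_of_nat: "padic_scaled p (of_nat n)"
  by (simp add: of_nat_poly padic_scaled_const)

lemma padic_scaled_pcompose: "padic_scaled p (pcompose q [:a, int p:])"
proof (induction q)
  case (pCons c q)
  have "padic_scaled p [:a, int p:]"
    by (auto simp: padic_scaled_def coeff_pCons split: nat.splits)
  thus ?case using pCons unfolding pcompose_pCons
    by (intro padic_scaled_add padic_scaled_mult padic_scaled_const)
qed (simp add: padic_scaled_def)

lemmas padic_scaled_intros = padic_scaled_add padic_scaled_diff padic_scaled_smult padic_scaled_mult
  padic_scaled_power padic_scaled_of_nat padic_scaled_pcompose

lemma pcompose_cong_1:
  assumes "[c * poly q a = 1] (mod int p)"
  shows "[:int p:] dvd smult c (pcompose q [:a, int p:]) - 1"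
  unfolding const_poly_dvd_iff
proof
  fix i
  show "int p dvd coeff (smult c (pcompose q [:a, int p:]) - 1) i"
  proof (cases i)
    case 0
    thus ?thesis using assms by (simp add: pcompose_coeff_0 cong_iff_dvd_diff)
  next
    case (Suc j)
    have "int p ^ Suc j dvd coeff (pcompose q [:a, int p:]) (Suc j)"
      using padic_scaled_pcompose unfolding padic_scaled_def by blast
    thus ?thesis using Suc by (auto intro: dvd_mult dvd_mult_left)
  qed
qed

lemma local_phase:
  fixes p m M t k :: nat and a C :: int and fp fm gp gm R :: "int poly"
  assumes p: "prime p" "odd p" and mM: "m \<ge> 2" "3 * m \<le> M"
    and dc: "dirichlet_char (p ^ m) chi"
    and logC: "\<And>u. [u = 1] (mod int p) \<Longrightarrow>
       chi u = ee (of_int (C * (u ^ (p ^ M) - 1)) / of_nat (p ^ (M + m)))"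
    and units: "\<not> int p dvd poly fp a" "\<not> int p dvd poly fm a" "\<not> int p dvd poly gm a"
    and R: "(pderiv gp * gm - gp * pderiv gm) * fp * fm
          + smult C ((pderiv fp * fm - fp * pderiv fm) * gm ^ 2) = smult (int p ^ t) R"
    and k: "k \<ge> 1" "m \<le> 2 * k + t" "t \<le> m"
  shows "\<exists>K w. norm K = 1 \<and> \<not> int p dvd w \<and>
    (\<forall>b. char_rat p chi fp fm (a + int p ^ k * b) * add_rat p m gp gm (a + int p ^ k * b)
       = K * ee (of_int (w * poly R a * b * int p ^ (k + t)) / of_nat (p ^ m)))"
proof -
  have p2: "p > 2" using p prime_ge_2_nat[of p] by (cases "p = 2") auto
  have "p ^ 1 \<le> p ^ M" using p2 mM by (intro power_increasing) auto
  hence "p ^ M = Suc (Suc (p ^ M - 2))" using p2 by simp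
  then obtain n where n: "p ^ M = Suc (Suc n)" by blast
  have cong1_nd: "\<not> int p dvd x" if "[x = 1] (mod int p)" for x
    using that p2 by (metis cong_dvd_iff int_dvd_int_iff nat_dvd_1_iff_1 of_nat_1 not_numeral_less_one)
  have inverse: "\<exists>c. [c * x = 1] (mod int p) \<and> \<not> int p dvd c" if "\<not> int p dvd x" for x
  proof -
    have "coprime (int p) x" using that p(1) by (simp add: prime_imp_coprime)
    hence "coprime x (int p)" by (metis coprime_commute)
    then obtain c where "[x * c = 1] (mod int p)" using cong_solve_coprime_int by blast
    thus ?thesis using cong1_nd by (metis dvd_mult mult.commute)
  qed
  have cop: "coprime x (int p ^ i)" if "\<not> int p dvd x" for x i
    by (metis that p(1) prime_imp_coprime prime_nat_int_transfer coprime_commute coprime_power_right_iff)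
  obtain c where c: "[c * poly fp a = 1] (mod int p)" "\<not> int p dvd c" using inverse units(1) by blast
  obtain c' where c': "[c' * poly fm a = 1] (mod int p)" "\<not> int p dvd c'" using inverse units(2) by blast
  obtain d where d: "[d * poly gm a = 1] (mod int p)" "\<not> int p dvd d" using inverse units(3) by blast
  define l where "l = [:a, int p:]"
  define A where "A = smult c (pcompose fp l)"
  define B where "B = smult c' (pcompose fm l)"
  define G where "G = smult d (pcompose gm l)"
  define K where "K = smult d (pcompose gp l)"
  have one: "[:int p:] dvd A - 1" "[:int p:] dvd B - 1" "[:int p:] dvd G - 1"
    unfolding A_def B_def G_def l_def using c c' d by (auto intro: pcompose_cong_1)
  have one_poly: "[poly X x = 1] (mod int p)" if X: "[:int p:] dvd X - 1" for X x
  proof -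
    obtain Y where "X - 1 = [:int p:] * Y" using X ..
    hence "poly (X - 1) x = poly ([:int p:] * Y) x" by simp
    thus ?thesis by (simp add: cong_iff_dvd_diff)
  qed
  define T where "T = smult (int p ^ M) (K * G ^ Suc n) + smult C (A ^ (p ^ M) - B ^ (p ^ M))"
  define J where "J = pderiv K * G ^ Suc n + of_nat (Suc n) * K * G ^ n * pderiv G
     + smult C (A ^ Suc n * pderiv A - B ^ Suc n * pderiv B)"
  define N where "N = (pderiv K * G - K * pderiv G) * A * B
     + smult C ((pderiv A * B - pderiv B * A) * G ^ 2)"
  define U where "U = (G ^ 2 * A * B) ^ Suc n"
  note deriv = phase_poly_deriv[OF one n, of K C, folded T_def J_def N_def, folded U_def]
  obtain Z where Z: "J = U * N + smult (int p ^ M) Z" using deriv(2) by blast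
  have pd: "pderiv (smult e (pcompose q l)) = smult (int p) (smult e (pcompose (pderiv q) l))" for e q
    by (simp add: pderiv_smult pderiv_pcompose l_def pderiv_pCons mult.commute)
  define \<kappa> where "\<kappa> = c * c' * d ^ 2"
  have "N = smult (int p * \<kappa>) (pcompose ((pderiv gp * gm - gp * pderiv gm) * fp * fm
          + smult C ((pderiv fp * fm - fp * pderiv fm) * gm ^ 2)) l)"
    unfolding N_def pd A_def B_def G_def K_def \<kappa>_def power2_eq_square
      pcompose_add pcompose_smult pcompose_mult pcompose_diff
    by (simp add: algebra_simps smult_add_right smult_diff_right)
  hence N: "N = smult (int p ^ Suc t) (smult \<kappa> (pcompose R l))"
    unfolding R by (simp add: pcompose_smult mult_ac)
  define E where "E = smult \<kappa> (U * pcompose R l)"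
  have JE: "J = smult (int p ^ Suc t) E + smult (int p ^ M) Z"
    unfolding Z N E_def by (simp add: mult_ac)
  have sc: "padic_scaled p A" "padic_scaled p B" "padic_scaled p G" "padic_scaled p K"
    unfolding A_def B_def G_def K_def l_def by (intro padic_scaled_intros)+
  have scE: "padic_scaled p E"
    unfolding E_def U_def l_def by (intro padic_scaled_intros sc)
  define J0 where "J0 = smult d (pcompose (pderiv gp) l) * G ^ Suc n
     + of_nat (Suc n) * K * G ^ n * smult d (pcompose (pderiv gm) l)
     + smult C (A ^ Suc n * smult c (pcompose (pderiv fp) l) - B ^ Suc n * smult c' (pcompose (pderiv fm) l))"
  have "J = smult (int p) J0"
    unfolding J_def J0_def
    unfolding pd[of d gp, folded K_def] pd[of d gm, folded G_def]
      pd[of c fp, folded A_def] pd[of c' fm, folded B_def]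
    by (simp add: algebra_simps smult_add_right smult_diff_right)
  moreover have "padic_scaled p J0"
    unfolding J0_def unfolding l_def by (intro padic_scaled_intros sc)
  ultimately have scJ: "int p ^ Suc i dvd coeff J i" for i
    by (simp add: padic_scaled_def)
  define w where "w = \<kappa> * poly U 0"
  have cE: "coeff E 0 = w * poly R a"
    by (simp add: E_def w_def l_def pcompose_coeff_0 coeff_mult_0 poly_0_coeff_0)
  have "[poly U 0 = 1] (mod int p)"
  proof -
    have "[(poly G 0 ^ 2 * poly A 0 * poly B 0) ^ Suc n = (1 ^ 2 * 1 * 1) ^ Suc n] (mod int p)"
      by (intro cong_pow cong_mult one_poly one)
    thus ?thesis by (simp add: U_def)
  qed
  from cong1_nd[OF this] have w: "\<not> int p dvd w"
    using c c' d p(1) by (simp add: w_def \<kappa>_def prime_dvd_mult_iff prime_dvd_power_iff)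
  define \<Theta> where "\<Theta> = (\<lambda>x. ee (of_int x / of_nat (p ^ (M + m))))"
  have \<Theta>_add: "\<Theta> (x + y) = \<Theta> x * \<Theta> y" for x y
    by (simp add: \<Theta>_def add_divide_distrib flip: ee_add)
  have \<Theta>_cong: "\<Theta> x = \<Theta> y" if "[x = y] (mod int p ^ (M + m))" for x y
    unfolding \<Theta>_def using that p2 by (intro ee_cong) auto
  have \<Theta>_pM: "\<Theta> (int p ^ M * x) = ee (of_int x / of_nat (p ^ m))" for x
    unfolding \<Theta>_def using p2 by (simp add: power_add)
  define K1 where "K1 = inverse (chi c * cnj (chi c'))"
  have nc: "norm (chi c) = 1" "norm (chi c') = 1"
    using norm_dirichlet_char[OF dc] cop c(2) c'(2) by auto
  hence nz: "chi c \<noteq> 0" "chi c' \<noteq> 0" by auto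
  from nc have nK1: "norm K1 = 1" by (simp add: K1_def norm_mult norm_inverse)
  have "char_rat p chi fp fm (a + int p ^ k * b) * add_rat p m gp gm (a + int p ^ k * b)
       = K1 * \<Theta> (poly T 0) * ee (of_int (w * poly R a * b * int p ^ (k + t)) / of_nat (p ^ m))" for b
  proof -
    define x where "x = int p ^ (k - 1) * b"
    have ax: "poly l x = a + int p ^ k * b"
      using k(1) by (simp add: l_def x_def power_eq_if mult.assoc mult.commute)
    have px: "poly A x = c * poly fp (a + int p ^ k * b)" "poly B x = c' * poly fm (a + int p ^ k * b)"
      "poly G x = d * poly gm (a + int p ^ k * b)" "poly K x = d * poly gp (a + int p ^ k * b)"
      unfolding A_def B_def G_def K_def by (simp_all add: poly_pcompose ax)
    define y where "y = a + int p ^ k * b"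
    note px = px[folded y_def]
    note ox = one_poly[OF one(1), of x] one_poly[OF one(2), of x] one_poly[OF one(3), of x]
    have nd: "\<not> int p dvd poly fm y" "\<not> int p dvd poly gm y"
      using cong1_nd[OF ox(2)] cong1_nd[OF ox(3)] px by auto
    have "chi c * chi (poly fp y) = \<Theta> (C * (poly A x ^ (p ^ M) - 1))"
      using logC[OF ox(1)] px by (simp add: \<Theta>_def dirichlet_char_mult[OF dc])
    hence 1: "chi (poly fp y) = \<Theta> (C * (poly A x ^ (p ^ M) - 1)) / chi c"
      using nz by (simp add: nonzero_eq_divide_eq mult.commute)
    have "chi c' * chi (poly fm y) = \<Theta> (C * (poly B x ^ (p ^ M) - 1))"
      using logC[OF ox(2)] px by (simp add: \<Theta>_def dirichlet_char_mult[OF dc])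
    hence "chi (poly fm y) = \<Theta> (C * (poly B x ^ (p ^ M) - 1)) / chi c'"
      using nz by (simp add: nonzero_eq_divide_eq mult.commute)
    hence 2: "cnj (chi (poly fm y)) = \<Theta> (- (C * (poly B x ^ (p ^ M) - 1))) / cnj (chi c')"
      by (simp add: \<Theta>_def cnj_ee)
    have "char_rat p chi fp fm y
        = K1 * (\<Theta> (C * (poly A x ^ (p ^ M) - 1)) * \<Theta> (- (C * (poly B x ^ (p ^ M) - 1))))"
      using nd by (simp add: char_rat_def 1 2 K1_def divide_inverse mult_ac)
    also have "\<dots> = K1 * \<Theta> (C * (poly A x ^ (p ^ M) - poly B x ^ (p ^ M)))"
      by (simp only: \<Theta>_add[symmetric]) (simp add: algebra_simps)
    finally have ch: "char_rat p chi fp fm y = K1 * \<Theta> (C * (poly A x ^ (p ^ M) - poly B x ^ (p ^ M)))" .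
    define s where "s = poly K x * poly G x ^ Suc n"
    have "int p ^ m dvd int p ^ (1 + M)" using mM by (intro le_imp_power_dvd) simp
    moreover have "int p ^ (1 + M) dvd poly G x ^ (p ^ M) - 1"
      using dvd_power_diff[of p 1 "poly G x" 1 M] ox(3) by (simp add: cong_iff_dvd_diff)
    ultimately have "[poly G x ^ (p ^ M) = 1] (mod int p ^ m)"
      unfolding cong_iff_dvd_diff by (rule dvd_trans)
    hence "[poly K x * poly G x ^ (p ^ M) = poly K x * 1] (mod int p ^ m)"
      by (intro cong_mult cong_refl)
    hence "[d * (s * poly gm y) = d * poly gp y] (mod int p ^ m)"
      by (simp add: s_def n px mult_ac)
    hence s: "[s * poly gm y = poly gp y] (mod int p ^ m)"
      using cong_mult_lcancel[OF cop[OF d(2)]] by blast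
    define u where "u = (SOME t. [t * poly gm y = poly gp y] (mod (int p ^ m)))"
    have "[u * poly gm y = poly gp y] (mod (int p ^ m))"
      unfolding u_def using s by (rule someI)
    hence "[u * poly gm y = s * poly gm y] (mod int p ^ m)" using s cong_sym cong_trans by blast
    hence "[u = s] (mod int p ^ m)"
      using cong_mult_rcancel[OF cop[OF nd(2)]] by blast
    hence "ee (of_int u / of_nat (p ^ m)) = ee (of_int s / of_nat (p ^ m))"
      using p2 by (intro ee_cong) auto
    hence ad: "add_rat p m gp gm y = \<Theta> (int p ^ M * s)"
      using nd by (simp add: add_rat_def u_def \<Theta>_pM)
    have "char_rat p chi fp fm y * add_rat p m gp gm y
        = K1 * (\<Theta> (C * (poly A x ^ (p ^ M) - poly B x ^ (p ^ M))) * \<Theta> (int p ^ M * s))"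
      unfolding ch ad by (simp only: mult.assoc)
    also have "\<dots> = K1 * \<Theta> (poly T x)"
      unfolding \<Theta>_add[symmetric] by (simp add: T_def s_def algebra_simps)
    also have "\<Theta> (poly T x) = \<Theta> (poly T 0 + int p ^ M * (w * poly R a * b * int p ^ (k + t)))"
    proof (rule \<Theta>_cong)
      have "int p ^ (M + m) dvd poly T x - poly T 0 - x * coeff (pderiv T) 0"
        unfolding x_def
        using scE by (intro poly_linear_approx[OF p k mM(2) deriv(1) JE scJ]) (simp add: padic_scaled_def)
      moreover have "int p ^ (M + m) dvd x * (int p ^ M * (int p ^ M * coeff Z 0))"
      proof -
        have "int p ^ (M + m) dvd int p ^ (M + M)" using mM by (intro le_imp_power_dvd) simp
        moreover have "x * (int p ^ M * (int p ^ M * coeff Z 0)) = int p ^ (M + M) * (x * coeff Z 0)"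
          by (simp add: power_add mult_ac)
        ultimately show ?thesis by (metis dvd_mult2)
      qed
      ultimately have "int p ^ (M + m) dvd (poly T x - poly T 0 - x * coeff (pderiv T) 0)
          + x * (int p ^ M * (int p ^ M * coeff Z 0))" by (rule dvd_add)
      also have "x * coeff (pderiv T) 0 = int p ^ M * (w * poly R a * b * (int p ^ (k - 1) * int p ^ Suc t))
          + x * (int p ^ M * (int p ^ M * coeff Z 0))"
        unfolding deriv(1) JE by (simp add: cE x_def algebra_simps)
      also have "int p ^ (k - 1) * int p ^ Suc t = int p ^ (k + t)"
        using k(1) by (simp only: power_add[symmetric]) simp
      finally show "[poly T x = poly T 0 + int p ^ M * (w * poly R a * b * int p ^ (k + t))]
          (mod int p ^ (M + m))"
        by (simp add: cong_iff_dvd_diff algebra_simps)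
    qed
    finally show ?thesis
      unfolding \<Theta>_add \<Theta>_pM y_def by (simp only: mult.assoc)
  qed
  moreover have "norm (K1 * \<Theta> (poly T 0)) = 1" using nK1 by (simp add: norm_mult \<Theta>_def)
  ultimately show ?thesis using w by blast
qed

lemma sum_ee_eq_0:
  assumes "p > 0" "r \<le> s" "\<not> int (p ^ r) dvd v"
  shows "(\<Sum>b\<in>{0..<int (p ^ s)}. ee (of_int (v * b) / of_nat (p ^ r))) = 0"
proof -
  define z where "z = ee (of_int v / of_nat (p ^ r))"
  have "(\<Sum>b\<in>{0..<int (p ^ s)}. ee (of_int (v * b) / of_nat (p ^ r))) = (\<Sum>b<p ^ s. z ^ b)"
    by (rule sum.reindex_bij_witness[of _ int nat])
       (auto simp: z_def ee_power mult_ac nat_less_iff simp flip: of_nat_power)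
  also have "\<dots> = 0"
  proof -
    have "z \<noteq> 1" unfolding z_def using assms by (subst ee_divide_eq_1_iff) auto
    moreover have "z ^ (p ^ s) = 1"
    proof -
      have "p ^ s = p ^ r * p ^ (s - r)" using assms(2) by (simp flip: power_add)
      hence "z ^ (p ^ s) = (z ^ (p ^ r)) ^ (p ^ (s - r))" by (simp only: power_mult)
      also have "z ^ (p ^ r) = 1"
        unfolding z_def ee_power using assms(1) by (simp add: ee_eq_1_iff)
      finally show ?thesis by simp
    qed
    ultimately show ?thesis by (simp add: geometric_sum)
  qed
  finally show ?thesis .
qed

lemma div_less_int:
  fixes a q s :: int
  assumes "0 < q" "a < s * q"
  shows "a div q < s"
proof -
  have "a div q * q \<le> a"
    using pos_mod_sign[OF assms(1), of a] minus_mod_eq_div_mult[of a q] by linarith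
  hence "a div q * q < s * q" using assms(2) by simp
  thus ?thesis using assms(1) by simp
qed

lemma sum_residues_split:
  assumes "p > 0" "k \<le> m"
  shows "(\<Sum>n\<in>{0..<int (p ^ m)}. f n)
    = (\<Sum>a\<in>{0..<int (p ^ k)}. \<Sum>b\<in>{0..<int (p ^ (m - k))}. f (a + int p ^ k * b))"
proof -
  let ?q = "int (p ^ k)" and ?s = "int (p ^ (m - k))"
  have q: "?q > 0" using assms(1) by simp
  have pm: "int (p ^ m) = ?q * ?s" using assms(2) by (simp flip: power_add)
  have "(\<Sum>n\<in>{0..<int (p ^ m)}. f n) = (\<Sum>(a, b)\<in>{0..<?q} \<times> {0..<?s}. f (a + ?q * b))"
  proof (rule sum.reindex_bij_witness[of _ "\<lambda>(a, b). a + ?q * b" "\<lambda>n. (n mod ?q, n div ?q)"], goal_cases)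
    case (2 n)
    hence "n div ?q < ?s" using q unfolding pm
      by (intro div_less_int) (auto simp: mult.commute)
    thus ?case using 2 q by (auto simp: pos_imp_zdiv_nonneg_iff)
  next
    case (4 c)
    then obtain a b where c: "c = (a, b)" "0 \<le> a" "a < ?q" "0 \<le> b" "b < ?s" by auto
    have "a + ?q * b < ?q * (b + 1)" using c by (simp add: algebra_simps)
    also have "\<dots> \<le> ?q * ?s" using c q by (intro mult_left_mono) auto
    finally show ?case using c q unfolding pm by auto
  qed (use q in auto)
  thus ?thesis by (simp add: sum.cartesian_product)
qed

lemma card_roots_mod_prime_power:
  fixes P :: "int poly"
  assumes "prime p" "\<not> int p dvd coeff P D" "\<And>i. i > D \<Longrightarrow> int p dvd coeff P i"
    and "D * e < r" "Suc e \<le> k"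
  shows "card {a \<in> {0..<int (p ^ k)}. int p ^ r dvd poly P a} \<le> D * p ^ (k - Suc e)"
proof -
  define S where "S = {a \<in> {0..<int (p ^ k)}. int p ^ r dvd poly P a}"
  let ?q = "int p ^ Suc e"
  have q: "?q > 0" using assms(1) by (simp add: prime_gt_0_nat)
  obtain A where A: "A \<subseteq> S" "inj_on (\<lambda>a. a mod ?q) A" "(\<lambda>a. a mod ?q) ` S = (\<lambda>a. a mod ?q) ` A"
    using subset_image_inj[of "(\<lambda>a. a mod ?q) ` S" "\<lambda>a. a mod ?q" S] by auto
  have finS: "finite S" by (rule finite_subset[of _ "{0..<int (p ^ k)}"]) (auto simp: S_def)
  have "card A \<le> D"
  proof (rule roots_mod_prime_power_bound[OF assms(1) _ _ _ assms(2,3,4)])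
    show "finite A" using A(1) finS finite_subset by blast
    show "\<not> ?q dvd a - b" if "a \<in> A" "b \<in> A" "a \<noteq> b" for a b
      using A(2) that by (auto simp: inj_on_def mod_eq_dvd_iff)
    show "int p ^ r dvd poly P a" if "a \<in> A" for a using that A(1) by (auto simp: S_def)
  qed
  have "S \<subseteq> (\<lambda>(c, b). c + ?q * b) ` (((\<lambda>a. a mod ?q) ` A) \<times> {0..<int (p ^ (k - Suc e))})"
  proof
    fix a assume a: "a \<in> S"
    have "int (p ^ k) = ?q * int (p ^ (k - Suc e))"
      using assms(5) by (simp del: power_Suc flip: power_add)
    hence "a < int (p ^ (k - Suc e)) * ?q" using a by (simp add: S_def mult.commute)
    hence "a div ?q < int (p ^ (k - Suc e))" by (rule div_less_int[OF q])
    moreover have "0 \<le> a div ?q" using a q by (simp add: S_def pos_imp_zdiv_nonneg_iff)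
    moreover have "a mod ?q \<in> (\<lambda>a. a mod ?q) ` A" using A(3) a by blast
    ultimately show "a \<in> (\<lambda>(c, b). c + ?q * b) ` (((\<lambda>a. a mod ?q) ` A) \<times> {0..<int (p ^ (k - Suc e))})"
      by (intro image_eqI[of _ _ "(a mod ?q, a div ?q)"]) auto
  qed
  moreover have finA: "finite A" using A(1) finS finite_subset by blast
  ultimately have "card S \<le> card (((\<lambda>a. a mod ?q) ` A) \<times> {0..<int (p ^ (k - Suc e))})"
    by (intro surj_card_le) auto
  also have "\<dots> \<le> D * p ^ (k - Suc e)"
    using \<open>card A \<le> D\<close> A(2) by (simp add: card_cartesian_product card_image nat_power_eq)
  finally show ?thesis by (simp add: S_def)
qed

lemma deg_mod_coeff:
  assumes "nonzero_mod p P"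
  shows "\<not> int p dvd coeff P (deg_mod p P)" "i > deg_mod p P \<Longrightarrow> int p dvd coeff P i"
proof -
  let ?S = "{i. \<not> int p dvd coeff P i}"
  have "?S \<subseteq> {..degree P}" by (auto intro: le_degree)
  hence fin: "finite ?S" using finite_subset by blast
  have "deg_mod p P = Max ?S" using assms by (simp add: deg_mod_def)
  moreover have "Max ?S \<in> ?S" using fin assms by (intro Max_in) (auto simp: nonzero_mod_def)
  ultimately show "\<not> int p dvd coeff P (deg_mod p P)" by simp
  assume "i > deg_mod p P"
  thus "int p dvd coeff P i" using Max_ge[OF fin, of i] \<open>deg_mod p P = Max ?S\<close> by auto
qed

lemma poly_cong_int:
  fixes q :: "int poly"
  assumes "[x = y] (mod n)"
  shows "[poly q x = poly q y] (mod n)"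
  by (induction q) (auto intro!: cong_add cong_mult assms)

lemma norm_char_rat_add_rat:
  assumes "dirichlet_char N chi"
  shows "norm (char_rat p chi fp fm n * add_rat p m gp gm n) \<le> 1"
proof -
  have "chi x = 0" if "\<not> coprime x (int N)" for x
    using that assms by (simp add: dirichlet_char_def)
  hence "norm (chi x) \<le> 1" for x
    using norm_dirichlet_char[OF assms, of x] by fastforce
  thus ?thesis
    by (auto simp: norm_mult char_rat_def add_rat_def intro!: mult_le_one)
qed

lemma critical_numerator_factor:
  fixes N U Hp Hm :: "int poly"
  assumes "prime p" "coprime Hp Hm" "Hm \<noteq> 0" "N * Hm = smult (int p ^ \<tau>) (Hp * U)"
  shows "\<exists>t V. t \<le> \<tau> \<and> V dvd U \<and> N = smult (int p ^ t) (Hp * V)"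
proof -
  define q where "q = [:int p:]"
  have q: "prime_elem q" using assms(1) by (simp add: q_def prime_elem_const_poly_iff)
  have eq: "N * Hm = Hp * (q ^ \<tau> * U)"
    using assms(4) by (simp add: q_def poly_const_pow)
  hence "Hm dvd Hp * (q ^ \<tau> * U)" by (metis dvd_triv_right)
  hence "Hm dvd q ^ \<tau> * U"
    using assms(2) by (simp add: coprime_commute coprime_dvd_mult_right_iff)
  then obtain W where W: "q ^ \<tau> * U = Hm * W" ..
  hence "N * Hm = (Hp * W) * Hm" using eq by (simp add: mult_ac)
  hence N: "N = Hp * W" using assms(3) by simp
  obtain t V Y where "t \<le> \<tau>" "W = q ^ t * V" "V * Y = U"
    using prime_elem_power_factor[OF q, of W Hm \<tau> U] W by (auto simp: mult.commute)
  thus ?thesis using N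
    by (intro exI[of _ t] exI[of _ V]) (auto simp: q_def poly_const_pow mult.left_commute)
qed

theorem theorem3p3:
  fixes p m :: nat and chi :: "int \<Rightarrow> complex"
  assumes "prime p" and "odd p" and "m \<ge> 2"
    and "primitive_char (p ^ m) chi"
  shows "\<exists>C::int. 1 \<le> C \<and> C \<le> int p ^ (m - 1) \<and> \<not> int p dvd C \<and>
    (\<forall>fp fm gp gm Hp Hm :: int poly. \<forall>\<tau>::nat.
       rat_fun fp fm \<longrightarrow> rat_fun gp gm \<longrightarrow>
       \<not> (rat_fun_const fp fm \<and> rat_fun_const gp gm) \<longrightarrow>
       rat_fun Hp Hm \<longrightarrow> nonzero_mod p Hp \<longrightarrow>
       \<comment> \<open>h = g' + C f'/f = p^tau H, written with the common denominator gm^2 fp fm\<close>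
       ((pderiv gp * gm - gp * pderiv gm) * fp * fm
          + smult C ((pderiv fp * fm - fp * pderiv fm) * gm ^ 2)) * Hm
         = smult (int p ^ \<tau>) (Hp * gm ^ 2 * fp * fm) \<longrightarrow>
       deg_mod p Hp \<ge> 1 \<longrightarrow>
       norm ((1 / of_nat (p ^ m)) *
             (\<Sum>n\<in>{0..<int (p ^ m)}. char_rat p chi fp fm n * add_rat p m gp gm n))
         \<le> real (deg_mod p Hp) *
            real p powr (- real_of_int \<lceil>real_of_int (int m - int \<tau> - 1) / real (2 * deg_mod p Hp)\<rceil>))"
proof -
  have p0: "p > 1" using assms(1) prime_gt_1_nat by blast
  have dc: "dirichlet_char (p ^ m) chi" using assms(4) by (simp add: primitive_char_def)
  obtain C where C: "1 \<le> C" "C \<le> int p ^ (m - 1)" "\<not> int p dvd C"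
    "\<And>u. [u = 1] (mod int p) \<Longrightarrow>
       chi u = ee (of_int (C * (u ^ (p ^ (3 * m)) - 1)) / of_nat (p ^ (3 * m + m)))"
    using primitive_char_log[OF assms(1-3) _ assms(4), of "3 * m"] by auto
  have "norm ((1 / of_nat (p ^ m)) *
             (\<Sum>n\<in>{0..<int (p ^ m)}. char_rat p chi fp fm n * add_rat p m gp gm n))
         \<le> real (deg_mod p Hp) *
            real p powr (- real_of_int \<lceil>real_of_int (int m - int \<tau> - 1) / real (2 * deg_mod p Hp)\<rceil>)"
    if H: "rat_fun Hp Hm" "nonzero_mod p Hp" "deg_mod p Hp \<ge> 1"
      and eq: "((pderiv gp * gm - gp * pderiv gm) * fp * fm
          + smult C ((pderiv fp * fm - fp * pderiv fm) * gm ^ 2)) * Hm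
         = smult (int p ^ \<tau>) (Hp * gm ^ 2 * fp * fm)"
    for fp fm gp gm Hp Hm :: "int poly" and \<tau> :: nat
  proof -
    define f where "f = (\<lambda>n. char_rat p chi fp fm n * add_rat p m gp gm n)"
    define D where "D = deg_mod p Hp"
    define \<epsilon> where "\<epsilon> = \<lceil>real_of_int (int m - int \<tau> - 1) / real (2 * D)\<rceil>"
    have f1: "norm (f n) \<le> 1" for n unfolding f_def by (rule norm_char_rat_add_rat[OF dc])
    have D1: "D \<ge> 1" using H(3) by (simp add: D_def)
    have "norm ((1 / of_nat (p ^ m)) * (\<Sum>n\<in>{0..<int (p ^ m)}. f n)) \<le> real D * real p powr (- real_of_int \<epsilon>)"
    proof (cases "m \<le> \<tau> + 1")
      case True
      hence "\<epsilon> \<le> 0" unfolding \<epsilon>_def by (simp add: divide_nonpos_nonneg)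
      hence "1 \<le> real p powr (- real_of_int \<epsilon>)" using p0 by (intro ge_one_powr_ge_zero) auto
      hence bound: "1 * 1 \<le> real D * real p powr (- real_of_int \<epsilon>)" using D1 by (intro mult_mono) auto
      have "norm (\<Sum>n\<in>{0..<int (p ^ m)}. f n) \<le> (\<Sum>n\<in>{0..<int (p ^ m)}. 1)"
        by (intro sum_norm_le f1)
      hence "norm (\<Sum>n\<in>{0..<int (p ^ m)}. f n) \<le> real p ^ m" by simp
      hence "norm ((1 / of_nat (p ^ m)) * (\<Sum>n\<in>{0..<int (p ^ m)}. f n)) \<le> 1"
        using p0 by (simp add: norm_mult norm_divide norm_power)
      with bound show ?thesis by simp
    next
      case False
      define U where "U = gm ^ 2 * fp * fm"
      obtain t V where t: "t \<le> \<tau>" "V dvd U"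
        "(pderiv gp * gm - gp * pderiv gm) * fp * fm
          + smult C ((pderiv fp * fm - fp * pderiv fm) * gm ^ 2) = smult (int p ^ t) (Hp * V)"
        using critical_numerator_factor[OF assms(1), of Hp Hm _ \<tau> U] H(1) eq
        unfolding rat_fun_def U_def by (metis (no_types, lifting) mult.assoc)
      define r where "r = (m - t) div 2"
      define k where "k = m - t - r"
      have k: "k \<ge> 1" "m \<le> 2 * k + t" "t \<le> m" "k + t + r = m" "r \<le> k" "r \<ge> 1" "k \<le> m"
        using False t(1) by (auto simp: k_def r_def)
      have inner: "norm (\<Sum>b\<in>{0..<int (p ^ (m - k))}. f (a + int p ^ k * b))
         \<le> (if int p ^ r dvd poly Hp a then real p ^ (m - k) else 0)" for a
      proof -
        have triv: "norm (\<Sum>b\<in>{0..<int (p ^ (m - k))}. f (a + int p ^ k * b)) \<le> real p ^ (m - k)"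
        proof -
          have "norm (\<Sum>b\<in>{0..<int (p ^ (m - k))}. f (a + int p ^ k * b)) \<le> (\<Sum>b\<in>{0..<int (p ^ (m - k))}. 1)"
            by (intro sum_norm_le f1)
          thus ?thesis by simp
        qed
        have "(\<Sum>b\<in>{0..<int (p ^ (m - k))}. f (a + int p ^ k * b)) = 0" if ndvd: "\<not> int p ^ r dvd poly Hp a"
        proof (cases "int p dvd poly fp a \<or> int p dvd poly fm a \<or> int p dvd poly gm a")
          case True
          have "f (a + int p ^ k * b) = 0" for b
          proof -
            have "[a + int p ^ k * b = a] (mod int p)"
              using k(1) by (simp add: cong_iff_dvd_diff dvd_mult2 dvd_power)
            hence dvd: "int p dvd poly q (a + int p ^ k * b) \<longleftrightarrow> int p dvd poly q a" for q
              using poly_cong_int cong_dvd_iff by blast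
            have chi0: "chi x = 0" if "int p dvd x" for x
            proof -
              have "int p dvd int (p ^ m)" using assms(3) by simp
              hence "\<not> coprime x (int (p ^ m))"
                using that p0 by (meson coprime_common_divisor not_prime_unit assms(1) prime_nat_int_transfer)
              thus ?thesis using dc by (simp add: dirichlet_char_def)
            qed
            show ?thesis using True dvd chi0 by (auto simp: f_def char_rat_def add_rat_def)
          qed
          thus ?thesis by simp
        next
          case False
          obtain K w where Kw: "\<not> int p dvd w" "\<And>b. f (a + int p ^ k * b)
               = K * ee (of_int (w * poly (Hp * V) a * b * int p ^ (k + t)) / of_nat (p ^ m))"
            using local_phase[OF assms(1-3) _ dc C(4) _ _ _ t(3) k(1-3), of a] False
            unfolding f_def by auto
          define v where "v = w * poly (Hp * V) a"
          have "real_of_int (v * b * int p ^ (k + t)) / real (p ^ m) = real_of_int (v * b) / real (p ^ r)" for b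
            using p0 by (simp add: k(4)[symmetric] power_add)
          hence "(\<Sum>b\<in>{0..<int (p ^ (m - k))}. f (a + int p ^ k * b))
             = K * (\<Sum>b\<in>{0..<int (p ^ (m - k))}. ee (of_int (v * b) / of_nat (p ^ r)))"
            unfolding Kw(2) sum_distrib_left v_def[symmetric] by (intro sum.cong) simp_all
          also have "(\<Sum>b\<in>{0..<int (p ^ (m - k))}. ee (of_int (v * b) / of_nat (p ^ r))) = 0"
          proof (rule sum_ee_eq_0)
            obtain Y where "U = V * Y" using t(2) ..
            hence "poly V a * poly Y a = poly gm a ^ 2 * poly fp a * poly fm a"
              by (metis U_def poly_mult poly_power)
            moreover have "\<not> int p dvd poly gm a ^ 2 * poly fp a * poly fm a"
              using False assms(1) by (simp add: prime_dvd_mult_iff prime_dvd_power_iff)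
            ultimately have "\<not> int p dvd poly V a" by (metis dvd_mult2)
            hence "\<not> int p dvd w * poly V a" using Kw(1) assms(1) by (simp add: prime_dvd_mult_iff)
            hence "coprime (int p) (w * poly V a)" using assms(1) by (intro prime_imp_coprime) auto
            hence "coprime (int p ^ r) (w * poly V a)" by (metis coprime_power_left_iff)
            moreover have "v = (w * poly V a) * poly Hp a" by (simp add: v_def)
            ultimately show "\<not> int (p ^ r) dvd v"
              using ndvd by (simp add: coprime_dvd_mult_right_iff)
          qed (use p0 k in auto)
          finally show ?thesis by simp
        qed
        with triv show ?thesis by auto
      qed
      define R where "R = {a \<in> {0..<int (p ^ k)}. int p ^ r dvd poly Hp a}"
      have eps: "real (2 * D) * (real_of_int \<epsilon> - 1) < real m - real \<tau> - 1" "\<epsilon> \<ge> 1"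
      proof -
        have "\<epsilon> = \<lceil>(real m - real \<tau> - 1) / real (2 * D)\<rceil>" by (simp add: \<epsilon>_def)
        hence "real_of_int \<epsilon> - 1 < (real m - real \<tau> - 1) / real (2 * D)" by linarith
        thus "real (2 * D) * (real_of_int \<epsilon> - 1) < real m - real \<tau> - 1" using D1 by (simp add: field_simps)
        have "(real m - real \<tau> - 1) / real (2 * D) > 0" using False D1 by (intro divide_pos_pos) auto
        thus "\<epsilon> \<ge> 1" unfolding \<epsilon>_def by simp
      qed
      define e where "e = nat (\<epsilon> - 1)"
      have e: "\<epsilon> = int (Suc e)" using eps(2) by (simp add: e_def)
      have "real (2 * (D * e)) < real m - real \<tau> - 1" using eps(1) by (simp add: e algebra_simps)
      hence "2 * (D * e) + \<tau> + 1 < m" by linarith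
      hence De: "D * e < r" using t(1) by (simp add: r_def)
      moreover have "1 * e \<le> D * e" using D1 by (intro mult_le_mono1)
      ultimately have ek: "Suc e \<le> k" using k(5) by linarith
      have "norm (\<Sum>n\<in>{0..<int (p ^ m)}. f n)
         \<le> (\<Sum>a\<in>{0..<int (p ^ k)}. if int p ^ r dvd poly Hp a then real p ^ (m - k) else 0)"
        using p0 k(7) inner by (subst sum_residues_split[of p k m]) (auto intro: sum_norm_le)
      also have "\<dots> = real (card R) * real p ^ (m - k)"
        unfolding R_def by (simp add: sum.If_cases Int_def)
      also have "real (card R) \<le> real (D * p ^ (k - Suc e))"
        unfolding R_def using deg_mod_coeff[OF H(2), folded D_def] assms(1) De ek
        by (intro of_nat_mono card_roots_mod_prime_power) auto
      finally have "norm (\<Sum>n\<in>{0..<int (p ^ m)}. f n) \<le> real (D * p ^ (k - Suc e)) * real p ^ (m - k)"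
        by (simp add: mult_right_mono)
      also have "\<dots> = real D * real p ^ (k - Suc e + (m - k))" by (simp add: power_add)
      also have "k - Suc e + (m - k) = m - Suc e" using ek k(7) by simp
      finally have "norm ((1 / of_nat (p ^ m)) * (\<Sum>n\<in>{0..<int (p ^ m)}. f n))
          \<le> real D * real p ^ (m - Suc e) / real p ^ m"
        using p0 by (simp add: norm_mult norm_divide norm_power divide_right_mono)
      also have "\<dots> = real D * real p powr (- real_of_int \<epsilon>)"
      proof -
        have "real p ^ m = real p ^ (m - Suc e) * real p ^ Suc e" using ek k(7) by (simp only: power_add[symmetric]) simp
        thus ?thesis using p0 by (simp add: e powr_minus divide_inverse del: power_Suc of_nat_Suc flip: powr_realpow)
      qed
      finally show ?thesis .
    qed
    thus ?thesis unfolding f_def \<epsilon>_def D_def .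
  qed
  thus ?thesis using C(1-3) by (intro exI[of _ C]) auto
qed

end
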